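(* Let $K$ be a compact space. Then the following are equivalent: (1) $K$ has the $\ell_1$-Grothendieck property; (2) $K$ has the $\Delta$-Grothendieck property; (3) $K$ does not have the finitely supported Josefson--Nissenzweig property (fsJNP); (4) $K$ does not have the countably supported Josefson--Nissenzweig property (csJNP).
   Context: All compact spaces are Hausdorff. A measure on $K$ is a signed $\sigma$-additive Radon measure on the Borel $\sigma$-algebra of $K$, with total variation norm $\|\cdot\|$. $\Delta(K)$ is the space of all finitely supported measures on $K$ (finite linear combinations of Dirac measures) and $\ell_1(K)$ is the space of all countably supported measures on $K$ (those of the form $\sum_{x}\alpha_x\delta_x$ with $\sum_x|\alpha_x|<\infty$). A sequence $\langle\mu_n\colon n\in\omega\rangle$ of measures on $K$ is weakly* convergent to a measure $\mu$ if $\lim_n\int_K f\,d\mu_n=\int_K f\,d\mu$ for every $f\in C(K)$, and weakly convergent to $\mu$ if $\lim_n\mu_n(B)=\mu(B)$ for every Borel $B\subseteq K$ (these coincide with the weak* and weak convergence in the dual Banach space $C(K)^*$). $K$ has the $\ell_1$-Grothendieck property (resp. the $\Delta$-Grothendieck property) if every weakly* convergent sequence of measures $\mu_n\in\ell_1(K)$ (resp. $\mu_n\in\Delta(K)$) is weakly convergent. A JN-sequence on $K$ is a sequence of measures of norm $1$ weakly* convergent to the zero measure. $K$ has the fsJNP (resp. csJNP) if it admits a JN-sequence $\langle\mu_n\colon n\in\omega\rangle$ with every $\mu_n\in\Delta(K)$ (resp. every $\mu_n\in\ell_1(K)$). *)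

theory Defs
  imports "HOL-Analysis.Analysis"
begin

definition borel_of :: "'a topology \<Rightarrow> 'a measure" where
  "borel_of K = sigma (topspace K) {U. openin K U}"

section \<open>Signed measures\<close>

text \<open>
  A signed measure on the measurable space \<open>M\<close> is a real-valued set function; only its values on
  \<open>sets M\<close> are meaningful, and of \<open>M\<close> only \<open>space M\<close> and \<open>sets M\<close> are used.
  Taking \<open>A n = {}\<close> for all \<open>n\<close> yields \<open>\<mu> {} = 0\<close>.
\<close>

definition signed_measure :: "'a measure \<Rightarrow> ('a set \<Rightarrow> real) \<Rightarrow> bool" where
  "signed_measure M \<mu> \<longleftrightarrow>
     (\<forall>A :: nat \<Rightarrow> 'a set. range A \<subseteq> sets M \<longrightarrow> disjoint_family A \<longrightarrow>
        (\<lambda>n. \<mu> (A n)) sums \<mu> (\<Union>n. A n))"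

definition variation :: "'a measure \<Rightarrow> ('a set \<Rightarrow> real) \<Rightarrow> 'a set \<Rightarrow> ennreal" where
  "variation M \<mu> A =
     (SUP P \<in> {P. finite P \<and> P \<subseteq> sets M \<and> partition_on A P}. \<Sum>B\<in>P. ennreal \<bar>\<mu> B\<bar>)"

text \<open>
  The positive part of the Jordan decomposition, as a library measure. Negative values of \<open>\<mu> B\<close>
  are truncated to 0 by \<open>ennreal\<close>, which does not affect the supremum since \<open>B = {}\<close> is allowed.
\<close>

definition positive_part :: "'a measure \<Rightarrow> ('a set \<Rightarrow> real) \<Rightarrow> 'a measure" where
  "positive_part M \<mu> =
     measure_of (space M) (sets M) (\<lambda>A. SUP B \<in> {B \<in> sets M. B \<subseteq> A}. ennreal (\<mu> B))"

definition negative_part :: "'a measure \<Rightarrow> ('a set \<Rightarrow> real) \<Rightarrow> 'a measure" where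
  "negative_part M \<mu> = positive_part M (\<lambda>B. - \<mu> B)"

definition signed_integral :: "'a measure \<Rightarrow> ('a set \<Rightarrow> real) \<Rightarrow> ('a \<Rightarrow> real) \<Rightarrow> real" where
  "signed_integral M \<mu> f =
     (\<integral>x. f x \<partial>positive_part M \<mu>) - (\<integral>x. f x \<partial>negative_part M \<mu>)"

section \<open>Radon measures on a topological space\<close>

text \<open>
  Radon means that the total variation is inner regular with respect to compact sets; on a compact
  Hausdorff space, outer regularity then follows by passing to complements.
\<close>

definition radon_measures :: "'a topology \<Rightarrow> ('a set \<Rightarrow> real) set" where
  "radon_measures K =
     {\<mu>. signed_measure (borel_of K) \<mu> \<and>
         (\<forall>B \<in> sets (borel_of K). \<forall>e::real. e > 0 \<longrightarrow>
            (\<exists>C. compactin K C \<and> C \<subseteq> B \<and> variation (borel_of K) \<mu> (B - C) < ennreal e))}"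

definition tv_norm :: "'a topology \<Rightarrow> ('a set \<Rightarrow> real) \<Rightarrow> ennreal" where
  "tv_norm K \<mu> = variation (borel_of K) \<mu> (topspace K)"

definition dirac :: "'a \<Rightarrow> 'a set \<Rightarrow> real" where
  "dirac x B = indicator B x"

definition Delta :: "'a topology \<Rightarrow> ('a set \<Rightarrow> real) set" where
  "Delta K =
     {\<mu> \<in> radon_measures K. \<exists>F \<alpha>. finite F \<and> F \<subseteq> topspace K \<and>
        (\<forall>B \<in> sets (borel_of K). \<mu> B = (\<Sum>x\<in>F. \<alpha> x * dirac x B))}"

text \<open>
  Absolute summability over all points of \<open>K\<close> forces all but countably many \<open>\<alpha> x\<close> to vanish.
\<close>

definition ell1 :: "'a topology \<Rightarrow> ('a set \<Rightarrow> real) set" where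
  "ell1 K =
     {\<mu> \<in> radon_measures K. \<exists>\<alpha>. (\<lambda>x. \<bar>\<alpha> x\<bar>) summable_on topspace K \<and>
        (\<forall>B \<in> sets (borel_of K). ((\<lambda>x. \<alpha> x * dirac x B) has_sum \<mu> B) (topspace K))}"

section \<open>Convergence, Grothendieck and Josefson--Nissenzweig properties\<close>

definition weak_star_converges ::
    "'a topology \<Rightarrow> (nat \<Rightarrow> 'a set \<Rightarrow> real) \<Rightarrow> ('a set \<Rightarrow> real) \<Rightarrow> bool" where
  "weak_star_converges K \<mu> \<nu> \<longleftrightarrow>
     (\<forall>f. continuous_map K euclideanreal f \<longrightarrow>
        (\<lambda>n. signed_integral (borel_of K) (\<mu> n) f) \<longlonglongrightarrow> signed_integral (borel_of K) \<nu> f)"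

definition weakly_converges ::
    "'a topology \<Rightarrow> (nat \<Rightarrow> 'a set \<Rightarrow> real) \<Rightarrow> ('a set \<Rightarrow> real) \<Rightarrow> bool" where
  "weakly_converges K \<mu> \<nu> \<longleftrightarrow> (\<forall>B \<in> sets (borel_of K). (\<lambda>n. \<mu> n B) \<longlonglongrightarrow> \<nu> B)"

definition grothendieck_for :: "'a topology \<Rightarrow> ('a set \<Rightarrow> real) set \<Rightarrow> bool" where
  "grothendieck_for K S \<longleftrightarrow>
     (\<forall>\<mu> :: nat \<Rightarrow> 'a set \<Rightarrow> real. (\<forall>n. \<mu> n \<in> S) \<longrightarrow>
        (\<exists>\<nu> \<in> radon_measures K. weak_star_converges K \<mu> \<nu>) \<longrightarrow>
        (\<exists>\<nu> \<in> radon_measures K. weakly_converges K \<mu> \<nu>))"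

definition ell1_Grothendieck_property :: "'a topology \<Rightarrow> bool" where
  "ell1_Grothendieck_property K \<longleftrightarrow> grothendieck_for K (ell1 K)"

definition Delta_Grothendieck_property :: "'a topology \<Rightarrow> bool" where
  "Delta_Grothendieck_property K \<longleftrightarrow> grothendieck_for K (Delta K)"

definition JN_sequence :: "'a topology \<Rightarrow> (nat \<Rightarrow> 'a set \<Rightarrow> real) \<Rightarrow> bool" where
  "JN_sequence K \<mu> \<longleftrightarrow>
     (\<forall>n. \<mu> n \<in> radon_measures K \<and> tv_norm K (\<mu> n) = 1) \<and> weak_star_converges K \<mu> (\<lambda>B. 0)"

definition fsJNP :: "'a topology \<Rightarrow> bool" where
  "fsJNP K \<longleftrightarrow> (\<exists>\<mu>. JN_sequence K \<mu> \<and> (\<forall>n. \<mu> n \<in> Delta K))"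

definition csJNP :: "'a topology \<Rightarrow> bool" where
  "csJNP K \<longleftrightarrow> (\<exists>\<mu>. JN_sequence K \<mu> \<and> (\<forall>n. \<mu> n \<in> ell1 K))"

end

theory Submission
  imports Defs
begin

text \<open>
  A countably supported measure on a compact Hausdorff space \<open>K\<close> is determined by a summable function
  on the points of \<open>K\<close>, its family of point masses. In these terms the total variation norm is the
  norm of \<open>\<ell>\<^sub>1(K)\<close> and the integral of a continuous \<open>f\<close> is \<open>\<Sum>\<^sub>\<infinity>x. a x * f x\<close>, so all four properties
  become statements about sequences in \<open>\<ell>\<^sub>1(K)\<close>. They are then linked in a cycle.

  The \<open>\<ell>\<^sub>1\<close>-Grothendieck property trivially implies the \<open>\<Delta>\<close>-Grothendieck property, because
  finitely supported measures are countably supported (\<open>Delta_subset_ell1\<close>).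

  The \<open>\<Delta>\<close>-Grothendieck property excludes the fsJNP
  (\<open>Delta_Grothendieck_imp_not_fsJNP\<close>): it would make a finitely supported JN-sequence converge on
  every countable set, and by Schur's gliding hump (\<open>schur_finitely_supported_Cauchy\<close>) such a sequence
  is norm Cauchy. But a norm Cauchy sequence of norm one is not weak* null, since a continuous
  function can follow the signs of the point masses of one late term (\<open>l1_Cauchy_not_weak_star_null\<close>).

  The csJNP implies the fsJNP (\<open>csJNP_imp_fsJNP\<close>): cutting each term of a JN-sequence down to a large
  finite set and renormalising moves it by an amount that tends to zero in norm, which does not
  affect weak* limits.

  Without the csJNP the \<open>\<ell>\<^sub>1\<close>-Grothendieck property holds (\<open>not_csJNP_imp_ell1_Grothendieck\<close>): a weak*
  convergent sequence in \<open>\<ell>\<^sub>1(K)\<close> that is not norm Cauchy has differences of arbitrarily late terms with norm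
  bounded away from zero, and these differences, normalised, form a JN-sequence. So every weak*
  convergent sequence in \<open>\<ell>\<^sub>1(K)\<close> is norm Cauchy, hence convergent in norm by completeness of \<open>\<ell>\<^sub>1(K)\<close>,
  and norm convergence implies convergence on every Borel set.
\<close>

section \<open>Borel sets of a topological space\<close>

lemma space_borel_of [simp]: "space (borel_of K) = topspace K"
  unfolding borel_of_def by (rule space_measure_of) (auto dest: openin_subset)

lemma openin_sets_borel_of: "openin K U \<Longrightarrow> U \<in> sets (borel_of K)"
  unfolding borel_of_def by (subst sets_measure_of) (auto dest: openin_subset)

lemma closedin_sets_borel_of:
  assumes "closedin K C"
  shows "C \<in> sets (borel_of K)"
proof -
  have "C = space (borel_of K) - (topspace K - C)"
    using closedin_subset[OF assms] by auto
  then show ?thesis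
    using assms openin_sets_borel_of by (metis closedin_def sets.compl_sets)
qed

lemma sets_borel_of_subset: "B \<in> sets (borel_of K) \<Longrightarrow> B \<subseteq> topspace K"
  using sets.sets_into_space[of B "borel_of K"] by simp

lemma countable_sets_borel_of:
  assumes "Hausdorff_space K" "countable A" "A \<subseteq> topspace K"
  shows "A \<in> sets (borel_of K)"
proof -
  have "{x} \<in> sets (borel_of K)" if "x \<in> A" for x
    using that assms closedin_Hausdorff_singleton closedin_sets_borel_of by fastforce
  then have "(\<Union>x\<in>A. {x}) \<in> sets (borel_of K)"
    using assms(2) by (intro sets.countable_UN') auto
  then show ?thesis by simp
qed

lemma continuous_map_borel_measurable:
  assumes "continuous_map K euclideanreal f"
  shows "f \<in> borel_measurable (borel_of K)"
proof (rule borel_measurableI)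
  fix S :: "real set" assume "open S"
  then have "openin K {x \<in> topspace K. f x \<in> S}"
    using assms by (intro openin_continuous_map_preimage) auto
  moreover have "f -` S \<inter> space (borel_of K) = {x \<in> topspace K. f x \<in> S}" by auto
  ultimately show "f -` S \<inter> space (borel_of K) \<in> sets (borel_of K)"
    using openin_sets_borel_of by metis
qed

section \<open>Absolutely summable functions and their norm\<close>

definition l1_norm :: "'a set \<Rightarrow> ('a \<Rightarrow> real) \<Rightarrow> real" where
  "l1_norm X a = (\<Sum>\<^sub>\<infinity>x\<in>X. \<bar>a x\<bar>)"

lemma summable_on_abs: "(\<lambda>x. \<bar>a x\<bar> :: real) summable_on X \<longleftrightarrow> a summable_on X"
  using summable_on_iff_abs_summable_on_real[of a X] by simp

lemma summable_on_dominated: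
  assumes "a summable_on X" "\<And>x. x \<in> X \<Longrightarrow> \<bar>b x\<bar> \<le> C * \<bar>a x :: real\<bar>"
  shows "(b :: _ \<Rightarrow> real) summable_on X"
proof -
  have "(\<lambda>x. C * \<bar>a x\<bar>) summable_on X"
    using assms(1) by (intro summable_on_cmult_right) (simp add: summable_on_abs)
  then have "(\<lambda>x. \<bar>b x\<bar>) summable_on X"
    by (rule summable_on_comparison_test) (use assms in auto)
  then show ?thesis by (simp add: summable_on_abs)
qed

lemma summable_on_bounded_mult:
  fixes a f :: "'a \<Rightarrow> real"
  assumes "a summable_on X" "\<And>x. x \<in> X \<Longrightarrow> \<bar>f x\<bar> \<le> C"
  shows "(\<lambda>x. a x * f x) summable_on X"
proof (rule summable_on_dominated[OF assms(1), of _ C])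
  fix x assume "x \<in> X"
  then show "\<bar>a x * f x\<bar> \<le> C * \<bar>a x\<bar>"
    using mult_right_mono[OF assms(2), of x "\<bar>a x\<bar>"] by (simp add: abs_mult mult.commute)
qed

lemma summable_on_diff_real:
  fixes a b :: "'a \<Rightarrow> real"
  assumes "a summable_on X" "b summable_on X"
  shows "(\<lambda>x. a x - b x) summable_on X"
  using summable_on_add[OF assms(1) summable_on_uminus[THEN iffD2, OF assms(2)]] by simp

lemma infsum_diff_real:
  fixes a b :: "'a \<Rightarrow> real"
  assumes "a summable_on X" "b summable_on X"
  shows "(\<Sum>\<^sub>\<infinity>x\<in>X. a x - b x) = infsum a X - infsum b X"
  using infsum_add[OF assms(1) summable_on_uminus[THEN iffD2, OF assms(2)]]
  by (simp add: infsum_uminus)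

lemma infsum_mult_le_l1_norm:
  fixes a f :: "'a \<Rightarrow> real"
  assumes a: "a summable_on X" and f: "\<And>x. x \<in> X \<Longrightarrow> \<bar>f x\<bar> \<le> C"
  shows "\<bar>\<Sum>\<^sub>\<infinity>x\<in>X. a x * f x\<bar> \<le> C * l1_norm X a"
proof -
  have "((\<lambda>x. C * \<bar>a x\<bar>) has_sum (C * l1_norm X a)) X"
    unfolding l1_norm_def using a
    by (intro has_sum_cmult_right has_sum_infsum) (simp add: summable_on_abs)
  moreover have "((\<lambda>x. a x * f x) has_sum (\<Sum>\<^sub>\<infinity>x\<in>X. a x * f x)) X"
    using summable_on_bounded_mult[OF assms] by simp
  moreover have "norm (a x * f x) \<le> C * \<bar>a x\<bar>" if "x \<in> X" for x
    using mult_right_mono[OF f[OF that], of "\<bar>a x\<bar>"] by (simp add: abs_mult mult.commute)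
  ultimately show ?thesis
    using norm_infsum_le by fastforce
qed

lemma infsum_subset_le_l1_norm:
  fixes a :: "'a \<Rightarrow> real"
  assumes "a summable_on X" "A \<subseteq> X"
  shows "\<bar>infsum a A\<bar> \<le> l1_norm X a"
proof -
  have "infsum a A = (\<Sum>\<^sub>\<infinity>x\<in>X. a x * indicator A x)"
    by (rule infsum_cong_neutral) (use assms(2) in auto)
  then show ?thesis
    using infsum_mult_le_l1_norm[OF assms(1), of "indicator A" 1] by (simp add: indicator_def)
qed

lemma infsum_finite_support:
  fixes a :: "'a \<Rightarrow> real"
  assumes "F \<subseteq> X" "finite F" "\<And>x. x \<in> X - F \<Longrightarrow> a x = 0"
  shows "infsum a X = sum a F"
proof -
  have "infsum a X = infsum a F"
    by (rule infsum_cong_neutral) (use assms in auto)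
  then show ?thesis using assms(2) by simp
qed

lemma l1_norm_nonneg: "0 \<le> l1_norm X a"
  unfolding l1_norm_def by (rule infsum_nonneg) simp

lemma l1_norm_divide: "l1_norm X (\<lambda>x. a x / c) = l1_norm X a / \<bar>c\<bar>"
  unfolding l1_norm_def using infsum_cmult_left'[of "\<lambda>x. \<bar>a x\<bar>" "inverse \<bar>c\<bar>" X]
  by (simp add: divide_inverse abs_mult)

text \<open>
  Weak* limits are insensitive to perturbations that vanish in norm.
\<close>

lemma infsum_mult_tendsto_l1_close:
  fixes a c :: "nat \<Rightarrow> 'a \<Rightarrow> real"
  assumes "\<And>n. a n summable_on X" "\<And>n. c n summable_on X"
    and lim: "(\<lambda>n. l1_norm X (\<lambda>x. a n x - c n x)) \<longlonglongrightarrow> 0"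
    and f: "\<And>x. x \<in> X \<Longrightarrow> \<bar>f x\<bar> \<le> C"
    and L: "(\<lambda>n. \<Sum>\<^sub>\<infinity>x\<in>X. a n x * f x) \<longlonglongrightarrow> L"
  shows "(\<lambda>n. \<Sum>\<^sub>\<infinity>x\<in>X. c n x * f x) \<longlonglongrightarrow> L"
proof (rule Lim_transform2[OF L])
  have to0: "(\<lambda>n. C * l1_norm X (\<lambda>x. a n x - c n x)) \<longlonglongrightarrow> 0"
    using tendsto_mult_right_zero[OF lim] by simp
  have bound: "norm ((\<Sum>\<^sub>\<infinity>x\<in>X. a n x * f x) - (\<Sum>\<^sub>\<infinity>x\<in>X. c n x * f x))
      \<le> C * l1_norm X (\<lambda>x. a n x - c n x)" for n
  proof -
    have "(\<lambda>x. a n x * f x) summable_on X" "(\<lambda>x. c n x * f x) summable_on X"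
      using assms(1,2) f by (auto intro: summable_on_bounded_mult)
    from infsum_diff_real[OF this] show ?thesis
      using infsum_mult_le_l1_norm[where f = f, OF summable_on_diff_real[OF assms(1)[of n] assms(2)[of n]] f]
      by (simp add: left_diff_distrib)
  qed
  show "(\<lambda>n. (\<Sum>\<^sub>\<infinity>x\<in>X. a n x * f x) - (\<Sum>\<^sub>\<infinity>x\<in>X. c n x * f x)) \<longlonglongrightarrow> 0"
    by (rule Lim_null_comparison[OF always_eventually[OF allI] to0]) (rule bound)
qed

definition l1_Cauchy :: "'a set \<Rightarrow> (nat \<Rightarrow> 'a \<Rightarrow> real) \<Rightarrow> bool" where
  "l1_Cauchy X a \<longleftrightarrow> (\<forall>e>0. \<exists>N. \<forall>m\<ge>N. \<forall>n\<ge>N. l1_norm X (\<lambda>x. a m x - a n x) < e)"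

lemma not_l1_CauchyE:
  assumes "\<not> l1_Cauchy X a"
  obtains e p q where "e > 0" "filterlim p sequentially sequentially" "filterlim q sequentially sequentially"
    "\<And>k. e \<le> l1_norm X (\<lambda>x. a (p k) x - a (q k) x)"
proof -
  obtain e where "e > 0" and "\<forall>N. \<exists>m\<ge>N. \<exists>n\<ge>N. e \<le> l1_norm X (\<lambda>x. a m x - a n x)"
    using assms by (auto simp: l1_Cauchy_def not_less)
  then obtain p q where "\<And>N. N \<le> p N" "\<And>N. N \<le> q N"
      "\<And>k. e \<le> l1_norm X (\<lambda>x. a (p k) x - a (q k) x)"
    by metis
  moreover from this have "filterlim p sequentially sequentially" "filterlim q sequentially sequentially"
    by (auto intro: filterlim_at_top_mono[OF filterlim_ident])
  ultimately show ?thesis using that \<open>e > 0\<close> by blast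
qed

text \<open>
  The limit is taken pointwise; finite partial sums of \<open>\<bar>a n x - b x\<bar>\<close> inherit the Cauchy bound by letting
  one index tend to infinity, which gives both summability and convergence in norm.
\<close>

lemma l1_complete:
  fixes a :: "nat \<Rightarrow> 'a \<Rightarrow> real"
  assumes a: "\<And>n. a n summable_on X" and C: "l1_Cauchy X a"
  obtains b where "b summable_on X" "(\<lambda>n. l1_norm X (\<lambda>x. a n x - b x)) \<longlonglongrightarrow> 0"
proof -
  have le: "(\<Sum>x\<in>F. \<bar>a m x - a n x\<bar>) \<le> l1_norm X (\<lambda>x. a m x - a n x)"
    if "finite F" "F \<subseteq> X" for F m n
    unfolding l1_norm_def
    using that summable_on_diff_real[OF a[of m] a[of n]]
    by (intro finite_sum_le_infsum) (simp_all add: summable_on_abs)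
  have "convergent (\<lambda>n. a n x)" if "x \<in> X" for x
  proof (intro Cauchy_convergent CauchyI)
    fix e :: real assume "e > 0"
    then obtain N where "\<forall>m\<ge>N. \<forall>n\<ge>N. l1_norm X (\<lambda>x. a m x - a n x) < e"
      using C by (auto simp: l1_Cauchy_def)
    moreover have "\<bar>a m x - a n x\<bar> \<le> l1_norm X (\<lambda>x. a m x - a n x)" for m n
      using le[of "{x}" m n] that by simp
    ultimately show "\<exists>M. \<forall>m\<ge>M. \<forall>n\<ge>M. norm (a m x - a n x) < e"
      by (metis le_less_trans real_norm_def)
  qed
  then have "\<forall>x\<in>X. \<exists>l. (\<lambda>n. a n x) \<longlonglongrightarrow> l" by (simp add: convergent_def)
  then obtain b where b: "\<And>x. x \<in> X \<Longrightarrow> (\<lambda>n. a n x) \<longlonglongrightarrow> b x" by metis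
  have "\<exists>N. \<forall>n\<ge>N. \<forall>F. finite F \<longrightarrow> F \<subseteq> X \<longrightarrow> (\<Sum>x\<in>F. \<bar>a n x - b x\<bar>) \<le> e" if e: "e > 0" for e
  proof -
    obtain N where N: "\<forall>m\<ge>N. \<forall>n\<ge>N. l1_norm X (\<lambda>x. a m x - a n x) < e"
      using C e by (auto simp: l1_Cauchy_def)
    have "(\<Sum>x\<in>F. \<bar>a n x - b x\<bar>) \<le> e" if "n \<ge> N" "finite F" "F \<subseteq> X" for n F
    proof (rule LIMSEQ_le_const2)
      show "(\<lambda>m. \<Sum>x\<in>F. \<bar>a n x - a m x\<bar>) \<longlonglongrightarrow> (\<Sum>x\<in>F. \<bar>a n x - b x\<bar>)"
        using that(3) by (intro tendsto_intros b) auto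
      show "\<exists>N. \<forall>m\<ge>N. (\<Sum>x\<in>F. \<bar>a n x - a m x\<bar>) \<le> e"
        using N that le[OF that(2,3)] by (metis less_imp_le order_trans)
    qed
    then show ?thesis by blast
  qed
  note approx = this
  have diff: "(\<lambda>x. a n x - b x) summable_on X"
    if "\<forall>F. finite F \<longrightarrow> F \<subseteq> X \<longrightarrow> (\<Sum>x\<in>F. \<bar>a n x - b x\<bar>) \<le> e" for n e
  proof -
    have "(\<lambda>x. \<bar>a n x - b x\<bar>) summable_on X"
      using that by (intro nonneg_bdd_above_summable_on) (auto intro!: bdd_aboveI[of _ e])
    then show ?thesis by (simp add: summable_on_abs)
  qed
  obtain N where "(\<lambda>x. a N x - b x) summable_on X"
    using approx[of 1] diff by (metis order_refl zero_less_one)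
  then have bs: "b summable_on X"
    using summable_on_diff_real[OF a[of N]] by fastforce
  moreover have "(\<lambda>n. l1_norm X (\<lambda>x. a n x - b x)) \<longlonglongrightarrow> 0"
  proof (rule LIMSEQ_I)
    fix e :: real assume "e > 0"
    then obtain N where N: "\<And>n F. n \<ge> N \<Longrightarrow> finite F \<Longrightarrow> F \<subseteq> X \<Longrightarrow> (\<Sum>x\<in>F. \<bar>a n x - b x\<bar>) \<le> e / 2"
      using approx[of "e / 2"] by auto
    have "l1_norm X (\<lambda>x. a n x - b x) \<le> e / 2" if "n \<ge> N" for n
      unfolding l1_norm_def using N[OF that] summable_on_diff_real[OF a bs]
      by (intro infsum_le_finite_sums) (simp_all add: summable_on_abs)
    then show "\<exists>N. \<forall>n\<ge>N. norm (l1_norm X (\<lambda>x. a n x - b x) - 0) < e"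
      using \<open>e > 0\<close> l1_norm_nonneg[of X] by (intro exI[of _ N]) fastforce
  qed
  ultimately show ?thesis by (rule that)
qed

section \<open>Atomic measures\<close>

text \<open>
  The sum of the point masses \<open>a x\<close>, obtained by pushing a weighted counting measure forward to the
  Borel sets. Negative weights are read as zero.
\<close>

definition point_masses :: "'a topology \<Rightarrow> ('a \<Rightarrow> real) \<Rightarrow> 'a measure" where
  "point_masses K a = distr (density (count_space (topspace K)) (\<lambda>x. ennreal (a x))) (borel_of K) (\<lambda>x. x)"

lemma sets_point_masses [simp]: "sets (point_masses K a) = sets (borel_of K)"
  and space_point_masses [simp]: "space (point_masses K a) = topspace K"
  by (simp_all add: point_masses_def)

lemma emeasure_point_masses:
  assumes a: "a summable_on topspace K" "\<And>x. x \<in> topspace K \<Longrightarrow> 0 \<le> a x"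
    and B: "B \<in> sets (borel_of K)"
  shows "emeasure (point_masses K a) B = ennreal (infsum a B)"
proof -
  have sub: "B \<subseteq> topspace K" using B by (rule sets_borel_of_subset)
  have sB: "a summable_on B" using a(1) sub by (rule summable_on_subset)
  then have asB: "Infinite_Set_Sum.abs_summable_on a B"
    by (intro abs_summable_equivalent[THEN iffD1] summable_on_iff_abs_summable_on_real[THEN iffD1])
  have "emeasure (point_masses K a) B =
      emeasure (density (count_space (topspace K)) (\<lambda>x. ennreal (a x))) B"
    unfolding point_masses_def using B sub
    by (subst emeasure_distr) (auto simp: measurable_def intro!: arg_cong2[where f=emeasure])
  also have "\<dots> = (\<integral>\<^sup>+x\<in>B. ennreal (a x) \<partial>count_space (topspace K))"
    using sub by (subst emeasure_density) auto
  also have "\<dots> = (\<integral>\<^sup>+x. ennreal (a x) \<partial>count_space B)"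
    using sub by (auto simp: nn_integral_count_space_indicator indicator_def intro!: nn_integral_cong nn_integral_count_space_eq)
  also have "\<dots> = ennreal (infsetsum a B)"
    using asB a(2) sub by (intro nn_integral_conv_infsetsum) auto
  also have "\<dots> = ennreal (infsum a B)"
    using infsetsum_infsum[OF asB] by simp
  finally show ?thesis .
qed

lemma integral_point_masses:
  assumes a: "a summable_on topspace K" "\<And>x. x \<in> topspace K \<Longrightarrow> 0 \<le> a x"
    and f: "f \<in> borel_measurable (borel_of K)" "\<And>x. x \<in> topspace K \<Longrightarrow> \<bar>f x\<bar> \<le> C"
  shows "(\<integral>x. f x \<partial>point_masses K a) = (\<Sum>\<^sub>\<infinity>x\<in>topspace K. a x * f x)"
proof -
  have "(\<integral>x. f x \<partial>point_masses K a) =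
      (\<integral>x. f x \<partial>density (count_space (topspace K)) (\<lambda>x. ennreal (a x)))"
    unfolding point_masses_def using f(1) by (subst integral_distr) (auto simp: measurable_def)
  also have "\<dots> = (\<integral>x. a x * f x \<partial>count_space (topspace K))"
    using a(2) by (subst integral_density) auto
  also have "\<dots> = infsetsum (\<lambda>x. a x * f x) (topspace K)"
    by (simp add: infsetsum_def)
  also have "\<dots> = (\<Sum>\<^sub>\<infinity>x\<in>topspace K. a x * f x)"
  proof (rule infsetsum_infsum)
    have "(\<lambda>x. a x * f x) summable_on topspace K"
      using a(1) f(2) by (rule summable_on_bounded_mult)
    then show "Infinite_Set_Sum.abs_summable_on (\<lambda>x. a x * f x) (topspace K)"
      by (intro abs_summable_equivalent[THEN iffD1] summable_on_iff_abs_summable_on_real[THEN iffD1])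
  qed
  finally show ?thesis .
qed

text \<open>
  Only values on Borel sets are compared, since a signed measure is arbitrary elsewhere.
\<close>

definition atomic :: "'a topology \<Rightarrow> ('a \<Rightarrow> real) \<Rightarrow> ('a set \<Rightarrow> real) \<Rightarrow> bool" where
  "atomic K a \<mu> \<longleftrightarrow> a summable_on topspace K \<and> (\<forall>B \<in> sets (borel_of K). \<mu> B = infsum a B)"

lemma atomic_infsum: "a summable_on topspace K \<Longrightarrow> atomic K a (infsum a)"
  by (simp add: atomic_def)

lemma atomic_uminus: "atomic K a \<mu> \<Longrightarrow> atomic K (\<lambda>x. - a x) (\<lambda>B. - \<mu> B)"
  by (simp add: atomic_def summable_on_uminus infsum_uminus)

lemma summable_on_pos_part:
  assumes "a summable_on X"
  shows "(\<lambda>x. max (a x) (0::real)) summable_on X"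
  by (rule summable_on_dominated[OF assms, of _ 1]) auto

text \<open>
  A summable function vanishes off a countable set, so the set of its positive point masses is Borel even
  though an uncountable union of points need not be. This makes the Hahn decomposition explicit.
\<close>

lemma support_sets_borel_of:
  assumes "Hausdorff_space K" "a summable_on topspace K" "A \<in> sets (borel_of K)"
  shows "{x \<in> A. 0 < (a x :: real)} \<in> sets (borel_of K)"
proof (rule countable_sets_borel_of[OF assms(1)])
  show sub: "{x \<in> A. 0 < a x} \<subseteq> topspace K" using sets_borel_of_subset[OF assms(3)] by auto
  show "countable {x \<in> A. 0 < a x}"
    by (rule countable_subset[OF _ summable_countable_real[OF assms(2)]]) (use sub in auto)
qed

text \<open>
  The supremum defining the positive part at \<open>A\<close> is attained at the Borel set of those points of \<open>A\<close> that
  carry positive mass.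
\<close>

lemma positive_part_atomic:
  assumes K: "Hausdorff_space K" and \<mu>: "atomic K a \<mu>"
  shows "positive_part (borel_of K) \<mu> = point_masses K (\<lambda>x. max (a x) 0)"
proof -
  let ?M = "borel_of K" and ?p = "\<lambda>x. max (a x) 0"
  have a: "a summable_on topspace K" and eq: "\<And>B. B \<in> sets ?M \<Longrightarrow> \<mu> B = infsum a B"
    using \<mu> by (auto simp: atomic_def)
  note p = summable_on_pos_part[OF a]
  have "(SUP B \<in> {B \<in> sets ?M. B \<subseteq> A}. ennreal (\<mu> B)) = emeasure (point_masses K ?p) A"
    if A: "A \<in> sets ?M" for A
  proof (rule antisym)
    show "(SUP B \<in> {B \<in> sets ?M. B \<subseteq> A}. ennreal (\<mu> B)) \<le> emeasure (point_masses K ?p) A"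
    proof (rule SUP_least, clarify)
      fix B assume B: "B \<in> sets ?M" "B \<subseteq> A"
      have sA: "A \<subseteq> topspace K" using A by (rule sets_borel_of_subset)
      have "infsum a B \<le> infsum ?p A"
        by (rule infsum_mono_neutral)
          (use B sA a p in \<open>auto intro: summable_on_subset\<close>)
      then show "ennreal (\<mu> B) \<le> emeasure (point_masses K ?p) A"
        using emeasure_point_masses[OF p _ A] eq[OF B(1)] by (simp add: ennreal_leI)
    qed
    let ?B = "{x \<in> A. 0 < a x}"
    have B: "?B \<in> sets ?M" by (rule support_sets_borel_of[OF K a A])
    have "infsum ?p A = infsum a ?B"
      by (rule infsum_cong_neutral) auto
    then have "emeasure (point_masses K ?p) A = ennreal (\<mu> ?B)"
      using emeasure_point_masses[OF p _ A] eq[OF B] by simp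
    also have "\<dots> \<le> (SUP B \<in> {B \<in> sets ?M. B \<subseteq> A}. ennreal (\<mu> B))"
      by (rule SUP_upper) (use B in auto)
    finally show "emeasure (point_masses K ?p) A \<le> (SUP B \<in> {B \<in> sets ?M. B \<subseteq> A}. ennreal (\<mu> B))" .
  qed
  then have "positive_part ?M \<mu> =
      measure_of (space ?M) (sets ?M) (emeasure (point_masses K ?p))"
    unfolding positive_part_def
    using sets.sigma_sets_eq[of ?M] by (intro measure_of_eq sets.space_closed) simp
  also have "\<dots> = point_masses K ?p"
    using measure_of_of_measure[of "point_masses K ?p"] by simp
  finally show ?thesis .
qed

lemma continuous_map_compact_bounded:
  assumes "compact_space K" "continuous_map K euclideanreal f"
  obtains C where "\<And>x. x \<in> topspace K \<Longrightarrow> \<bar>f x\<bar> \<le> C"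
proof -
  have "compactin euclideanreal (f ` topspace K)"
    using assms image_compactin unfolding compact_space_def by blast
  then have "bounded (f ` topspace K)"
    by (simp add: compact_imp_bounded)
  then show ?thesis using that unfolding bounded_real by blast
qed

lemma signed_integral_atomic:
  assumes K: "compact_space K" "Hausdorff_space K" and \<mu>: "atomic K a \<mu>"
    and f: "continuous_map K euclideanreal f"
  shows "signed_integral (borel_of K) \<mu> f = (\<Sum>\<^sub>\<infinity>x\<in>topspace K. a x * f x)"
proof -
  let ?X = "topspace K"
  obtain C where C: "\<And>x. x \<in> ?X \<Longrightarrow> \<bar>f x\<bar> \<le> C"
    using continuous_map_compact_bounded[OF K(1) f] by blast
  have a: "a summable_on ?X" using \<mu> by (simp add: atomic_def)
  have a': "(\<lambda>x. - a x) summable_on ?X" using a by (simp add: summable_on_uminus)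
  note fm = continuous_map_borel_measurable[OF f]
  note p = summable_on_pos_part[OF a] and n = summable_on_pos_part[OF a']
  have "signed_integral (borel_of K) \<mu> f =
      (\<Sum>\<^sub>\<infinity>x\<in>?X. max (a x) 0 * f x) - (\<Sum>\<^sub>\<infinity>x\<in>?X. max (- a x) 0 * f x)"
    unfolding signed_integral_def negative_part_def
      positive_part_atomic[OF K(2) \<mu>] positive_part_atomic[OF K(2) atomic_uminus[OF \<mu>]]
    using integral_point_masses[OF p _ fm C] integral_point_masses[OF n _ fm C] by simp
  also have "\<dots> = (\<Sum>\<^sub>\<infinity>x\<in>?X. max (a x) 0 * f x - max (- a x) 0 * f x)"
    by (rule infsum_diff_real[symmetric])
      (auto intro: summable_on_bounded_mult[OF p C] summable_on_bounded_mult[OF n C])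
  also have "\<dots> = (\<Sum>\<^sub>\<infinity>x\<in>?X. a x * f x)"
    by (rule infsum_cong) (auto simp: max_def)
  finally show ?thesis .
qed

text \<open>
  No partition gives more than the sum of the absolute point masses, by the triangle inequality;
  splitting into the points of positive mass and the rest reaches that value.
\<close>

lemma variation_atomic:
  assumes K: "Hausdorff_space K" and \<mu>: "atomic K a \<mu>" and A: "A \<in> sets (borel_of K)"
  shows "variation (borel_of K) \<mu> A = ennreal (l1_norm A a)"
proof (rule antisym)
  let ?M = "borel_of K"
  let ?N = "point_masses K (\<lambda>x. \<bar>a x\<bar>)"
  have a: "a summable_on topspace K" and eq: "\<And>B. B \<in> sets ?M \<Longrightarrow> \<mu> B = infsum a B"
    using \<mu> by (auto simp: atomic_def)
  have sA: "a summable_on A" using a sets_borel_of_subset[OF A] by (rule summable_on_subset)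
  have em: "emeasure ?N B = ennreal (l1_norm B a)" if "B \<in> sets ?M" for B
    unfolding l1_norm_def by (rule emeasure_point_masses) (use a that in \<open>auto simp: summable_on_abs\<close>)
  show "variation ?M \<mu> A \<le> ennreal (l1_norm A a)"
    unfolding variation_def
  proof (rule SUP_least, clarify)
    fix P assume P: "finite P" "P \<subseteq> sets ?M" "partition_on A P"
    have "(\<Sum>B\<in>P. ennreal \<bar>\<mu> B\<bar>) \<le> (\<Sum>B\<in>P. emeasure ?N B)"
    proof (rule sum_mono)
      fix B assume "B \<in> P"
      then have B: "B \<in> sets ?M" "B \<subseteq> A" using P by (auto simp: partition_on_def)
      have "\<bar>\<mu> B\<bar> \<le> l1_norm B a"
        using infsum_subset_le_l1_norm[OF summable_on_subset[OF sA B(2)] subset_refl] eq[OF B(1)]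
        by simp
      then show "ennreal \<bar>\<mu> B\<bar> \<le> emeasure ?N B"
        using em[OF B(1)] by (simp add: ennreal_leI)
    qed
    also have "\<dots> = emeasure ?N (\<Union>P)"
    proof -
      have "disjoint_family_on (\<lambda>B. B) P"
        using P(3) unfolding disjoint_family_on_def partition_on_def disjoint_def by blast
      then show ?thesis using sum_emeasure[of "\<lambda>B. B" P ?N] P(1,2) by simp
    qed
    also have "\<dots> = ennreal (l1_norm A a)"
      using P(3) em[OF A] by (simp add: partition_on_def)
    finally show "(\<Sum>B\<in>P. ennreal \<bar>\<mu> B\<bar>) \<le> ennreal (l1_norm A a)" .
  qed
  let ?p = "{x \<in> A. 0 < a x}" let ?n = "A - ?p"
  have sets: "?p \<in> sets ?M" "?n \<in> sets ?M"
    using support_sets_borel_of[OF K a A] A by auto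
  have s: "(\<lambda>x. \<bar>a x\<bar>) summable_on ?p" "(\<lambda>x. \<bar>a x\<bar>) summable_on ?n"
    using sA by (auto simp: summable_on_abs intro: summable_on_subset)
  have "l1_norm A a = (\<Sum>\<^sub>\<infinity>x\<in>?p \<union> ?n. \<bar>a x\<bar>)"
    unfolding l1_norm_def by (rule infsum_cong_neutral) auto
  also have "\<dots> = (\<Sum>\<^sub>\<infinity>x\<in>?p. \<bar>a x\<bar>) + (\<Sum>\<^sub>\<infinity>x\<in>?n. \<bar>a x\<bar>)"
    by (rule infsum_Un_disjoint) (use s in auto)
  also have "(\<Sum>\<^sub>\<infinity>x\<in>?p. \<bar>a x\<bar>) = (\<Sum>\<^sub>\<infinity>x\<in>?p. a x)"
    by (rule infsum_cong) auto
  also have "(\<Sum>\<^sub>\<infinity>x\<in>?n. \<bar>a x\<bar>) = - (\<Sum>\<^sub>\<infinity>x\<in>?n. a x)"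
    unfolding infsum_uminus[symmetric] by (rule infsum_cong) auto
  finally have norm: "l1_norm A a \<le> \<bar>\<mu> ?p\<bar> + \<bar>\<mu> ?n\<bar>"
    using eq[OF sets(1)] eq[OF sets(2)] by linarith
  \<comment> \<open>The parts of a partition must be nonempty, hence the removal of \<open>{}\<close>.\<close>
  let ?P = "{?p, ?n} - {{}}"
  have "\<mu> {} = 0" using eq[of "{}"] by simp
  then have "ennreal (\<bar>\<mu> ?p\<bar> + \<bar>\<mu> ?n\<bar>) = (\<Sum>B\<in>?P. ennreal \<bar>\<mu> B\<bar>)"
  proof -
    have "(\<Sum>B\<in>?P. ennreal \<bar>\<mu> B\<bar>) = (\<Sum>B\<in>{?p, ?n}. ennreal \<bar>\<mu> B\<bar>)"
      by (rule sum.mono_neutral_left) (use \<open>\<mu> {} = 0\<close> in auto)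
    also have "\<dots> = ennreal \<bar>\<mu> ?p\<bar> + ennreal \<bar>\<mu> ?n\<bar>"
    proof (cases "?p = ?n")
      case True
      then have "?p = {}" by blast
      then have "\<mu> ?p = 0" using \<open>\<mu> {} = 0\<close> by (simp only:)
      with True show ?thesis by simp
    qed simp
    finally show ?thesis by simp
  qed
  also have "\<dots> \<le> variation ?M \<mu> A"
    unfolding variation_def
  proof (rule SUP_upper)
    have "partition_on A ?P"
      by (rule partition_onI) (auto simp: disjnt_def)
    moreover have "?P \<subseteq> sets ?M" using sets by blast
    ultimately show "?P \<in> {P. finite P \<and> P \<subseteq> sets ?M \<and> partition_on A P}"
      by simp
  qed
  finally show "ennreal (l1_norm A a) \<le> variation ?M \<mu> A"
    using norm by (meson ennreal_leI order_trans)
qed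

lemma tv_norm_atomic:
  assumes "Hausdorff_space K" "atomic K a \<mu>"
  shows "tv_norm K \<mu> = ennreal (l1_norm (topspace K) a)"
  unfolding tv_norm_def by (rule variation_atomic[OF assms]) (metis sets.top space_borel_of)

text \<open>
  Countable additivity comes from the Jordan decomposition into two finite point-mass measures. Inner
  regularity holds because finite sets are compact and carry all but \<open>e\<close> of the mass.
\<close>

lemma atomic_radon:
  assumes K: "Hausdorff_space K" and \<mu>: "atomic K a \<mu>"
  shows "\<mu> \<in> radon_measures K"
proof -
  let ?M = "borel_of K"
  have a: "a summable_on topspace K" and eq: "\<And>B. B \<in> sets ?M \<Longrightarrow> \<mu> B = infsum a B"
    using \<mu> by (auto simp: atomic_def)
  have a': "(\<lambda>x. - a x) summable_on topspace K" using a by (simp add: summable_on_uminus)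
  define P where "P = point_masses K (\<lambda>x. max (a x) 0)"
  define N where "N = point_masses K (\<lambda>x. max (- a x) 0)"
  note p = summable_on_pos_part[OF a] and n = summable_on_pos_part[OF a']
  have emP: "emeasure P B = ennreal (\<Sum>\<^sub>\<infinity>x\<in>B. max (a x) 0)"
    and emN: "emeasure N B = ennreal (\<Sum>\<^sub>\<infinity>x\<in>B. max (- a x) 0)" if "B \<in> sets ?M" for B
    unfolding P_def N_def using emeasure_point_masses[OF p _ that] emeasure_point_masses[OF n _ that]
    by auto
  have top: "topspace K \<in> sets ?M" by (metis sets.top space_borel_of)
  interpret P: finite_measure P by standard (simp add: emP[OF top] P_def[THEN arg_cong[where f=space]])
  interpret N: finite_measure N by standard (simp add: emN[OF top] N_def[THEN arg_cong[where f=space]])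
  have jordan: "\<mu> B = measure P B - measure N B" if B: "B \<in> sets ?M" for B
  proof -
    have sub: "B \<subseteq> topspace K" using B by (rule sets_borel_of_subset)
    have "measure P B = (\<Sum>\<^sub>\<infinity>x\<in>B. max (a x) 0)" "measure N B = (\<Sum>\<^sub>\<infinity>x\<in>B. max (- a x) 0)"
      using emP[OF B] emN[OF B] by (simp_all add: measure_def infsum_nonneg)
    moreover have "(\<Sum>\<^sub>\<infinity>x\<in>B. max (a x) 0 - max (- a x) 0) = infsum a B"
      by (rule infsum_cong) auto
    ultimately show ?thesis
      using infsum_diff_real[OF summable_on_subset[OF p sub] summable_on_subset[OF n sub]] eq[OF B]
      by simp
  qed
  have "signed_measure ?M \<mu>"
    unfolding signed_measure_def
  proof (intro allI impI)
    fix A :: "nat \<Rightarrow> 'a set"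
    assume A: "range A \<subseteq> sets ?M" "disjoint_family A"
    then have "(\<lambda>i. measure P (A i) - measure N (A i)) sums (measure P (\<Union>i. A i) - measure N (\<Union>i. A i))"
      by (intro sums_diff P.finite_measure_UNION N.finite_measure_UNION) (auto simp: P_def N_def)
    moreover have "\<And>i. A i \<in> sets ?M" "(\<Union>i. A i) \<in> sets ?M" using A(1) by auto
    ultimately show "(\<lambda>n. \<mu> (A n)) sums \<mu> (\<Union>n. A n)" by (simp add: jordan)
  qed
  moreover have "\<exists>C. compactin K C \<and> C \<subseteq> B \<and> variation ?M \<mu> (B - C) < ennreal e"
    if B: "B \<in> sets ?M" and e: "e > 0" for B and e :: real
  proof -
    have sub: "B \<subseteq> topspace K" using B by (rule sets_borel_of_subset)
    have sB: "(\<lambda>x. \<bar>a x\<bar>) summable_on B"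
      using summable_on_subset[OF a sub] by (simp add: summable_on_abs)
    obtain F where F: "finite F" "F \<subseteq> B"
        "dist (\<Sum>x\<in>F. \<bar>a x\<bar>) (\<Sum>\<^sub>\<infinity>x\<in>B. \<bar>a x\<bar>) \<le> e / 2"
      using infsum_finite_approximation[OF sB, of "e / 2"] e by auto
    have "(\<Sum>\<^sub>\<infinity>x\<in>B. \<bar>a x\<bar>) = (\<Sum>\<^sub>\<infinity>x\<in>F \<union> (B - F). \<bar>a x\<bar>)"
      by (rule infsum_cong_neutral) (use F in auto)
    also have "\<dots> = (\<Sum>\<^sub>\<infinity>x\<in>F. \<bar>a x\<bar>) + l1_norm (B - F) a"
      unfolding l1_norm_def using F(1,2)
      by (intro infsum_Un_disjoint summable_on_subset[OF sB]) auto
    finally have "l1_norm (B - F) a < e"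
      using F e by (simp add: dist_real_def)
    moreover have "F \<in> sets ?M"
      using F sub by (intro countable_sets_borel_of[OF K]) (auto simp: countable_finite)
    then have "variation ?M \<mu> (B - F) = ennreal (l1_norm (B - F) a)"
      using B by (intro variation_atomic[OF K \<mu>]) auto
    moreover have "compactin K F"
      using F sub by (intro finite_imp_compactin) auto
    ultimately show ?thesis
      using F(2) e by (auto intro!: exI[of _ F] ennreal_lessI)
  qed
  ultimately show ?thesis by (auto simp: radon_measures_def)
qed

lemma has_sum_dirac_iff:
  assumes "a summable_on X" "B \<subseteq> X"
  shows "((\<lambda>x. a x * dirac x B) has_sum s) X \<longleftrightarrow> s = infsum a B"
proof -
  have "((\<lambda>x. a x * dirac x B) has_sum s) X \<longleftrightarrow> (a has_sum s) B"
    by (rule has_sum_cong_neutral) (use assms(2) in \<open>auto simp: dirac_def\<close>)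
  then show ?thesis
    using summable_on_subset[OF assms] by (auto simp: has_sum_iff)
qed

lemma ell1_iff_atomic:
  assumes "Hausdorff_space K"
  shows "\<mu> \<in> ell1 K \<longleftrightarrow> (\<exists>a. atomic K a \<mu>)"
proof -
  have "a summable_on topspace K \<and> (\<forall>B \<in> sets (borel_of K). ((\<lambda>x. a x * dirac x B) has_sum \<mu> B) (topspace K))
    \<longleftrightarrow> atomic K a \<mu>" for a
    unfolding atomic_def using has_sum_dirac_iff sets_borel_of_subset by metis
  then show ?thesis
    unfolding ell1_def using atomic_radon[OF assms] by (auto simp: summable_on_abs)
qed

lemma Delta_iff_atomic:
  assumes "Hausdorff_space K"
  shows "\<mu> \<in> Delta K \<longleftrightarrow> (\<exists>a. atomic K a \<mu> \<and> finite {x \<in> topspace K. a x \<noteq> 0})"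
proof
  assume "\<mu> \<in> Delta K"
  then obtain F \<alpha> where F: "finite F" "F \<subseteq> topspace K"
    and eq: "\<And>B. B \<in> sets (borel_of K) \<Longrightarrow> \<mu> B = (\<Sum>x\<in>F. \<alpha> x * dirac x B)"
    by (auto simp: Delta_def)
  let ?a = "\<lambda>x. if x \<in> F then \<alpha> x else 0"
  have "infsum ?a B = (\<Sum>x\<in>F. \<alpha> x * dirac x B)" for B
  proof -
    have "infsum ?a B = (\<Sum>\<^sub>\<infinity>x\<in>F. \<alpha> x * dirac x B)"
      by (rule infsum_cong_neutral) (auto simp: dirac_def)
    then show ?thesis using F(1) by simp
  qed
  moreover have "?a summable_on topspace K"
    using F summable_on_cong_neutral[of "topspace K" F ?a ?a] by auto
  ultimately have "atomic K ?a \<mu>" by (simp add: atomic_def eq)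
  moreover have "finite {x \<in> topspace K. ?a x \<noteq> 0}"
    by (rule finite_subset[OF _ F(1)]) auto
  ultimately show "\<exists>a. atomic K a \<mu> \<and> finite {x \<in> topspace K. a x \<noteq> 0}" by blast
next
  assume "\<exists>a. atomic K a \<mu> \<and> finite {x \<in> topspace K. a x \<noteq> 0}"
  then obtain a where a: "atomic K a \<mu>" "finite {x \<in> topspace K. a x \<noteq> 0}" by blast
  let ?F = "{x \<in> topspace K. a x \<noteq> 0}"
  have "\<mu> B = (\<Sum>x\<in>?F. a x * dirac x B)" if B: "B \<in> sets (borel_of K)" for B
  proof -
    have "infsum a B = (\<Sum>\<^sub>\<infinity>x\<in>?F. a x * dirac x B)"
      by (rule infsum_cong_neutral) (use sets_borel_of_subset[OF B] in \<open>auto simp: dirac_def\<close>)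
    then show ?thesis using a B by (simp add: atomic_def)
  qed
  then show "\<mu> \<in> Delta K"
    unfolding Delta_def using atomic_radon[OF assms a(1)] a(2) by blast
qed

section \<open>The Schur property for finitely supported functions\<close>

text \<open>
  One step of the gliding hump. The functions \<open>d k\<close> have norm at least \<open>e\<close> infinitely often but tend to zero at each
  point, so some late \<open>d k\<close> has all but \<open>e/8\<close> of its mass outside the finite set \<open>F\<close> treated so far.
  The old set \<open>A\<close> is enlarged by points outside \<open>F\<close> where \<open>d k\<close> has constant sign, so that the sum of
  \<open>d k\<close> over the new set is large while earlier sums are left alone.
\<close>

lemma gliding_hump_step:
  fixes d :: "nat \<Rightarrow> 'a \<Rightarrow> real"
  assumes fin: "\<And>k. finite {x \<in> X. d k x \<noteq> 0}"
    and pt: "\<And>x. x \<in> X \<Longrightarrow> (\<lambda>k. d k x) \<longlonglongrightarrow> 0"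
    and e: "e > 0" and big: "\<And>N. \<exists>k\<ge>N. e \<le> l1_norm X (d k)"
    and F: "finite F" "F \<subseteq> X" "A \<subseteq> F"
  obtains k F' A' where "N < k" "finite F'" "F' \<subseteq> X" "F \<subseteq> F'" "{x \<in> X. d k x \<noteq> 0} \<subseteq> F'"
    "A' \<subseteq> F'" "A' \<inter> F = A" "e / 4 \<le> \<bar>sum (d k) A'\<bar>"
proof -
  have "(\<lambda>k. \<Sum>x\<in>F. \<bar>d k x\<bar>) \<longlonglongrightarrow> 0"
    using F(2) by (intro tendsto_null_sum tendsto_rabs_zero pt) auto
  then have "eventually (\<lambda>k. (\<Sum>x\<in>F. \<bar>d k x\<bar>) < e / 8) sequentially"
    using e by (intro order_tendstoD) auto
  then obtain M where M: "\<And>k. k \<ge> M \<Longrightarrow> (\<Sum>x\<in>F. \<bar>d k x\<bar>) < e / 8"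
    by (auto simp: eventually_sequentially)
  obtain k where k: "k \<ge> max M (Suc N)" "e \<le> l1_norm X (d k)" using big by blast
  have small: "(\<Sum>x\<in>F. \<bar>d k x\<bar>) < e / 8" using M k(1) by simp
  define R where "R = {x \<in> X. d k x \<noteq> 0} - F"
  have finR: "finite R" using fin by (simp add: R_def)
  let ?P = "{x \<in> R. 0 < d k x}" and ?Q = "{x \<in> R. \<not> 0 < d k x}"
  have "l1_norm X (d k) = (\<Sum>x\<in>F \<union> R. \<bar>d k x\<bar>)"
    unfolding l1_norm_def
    by (rule infsum_finite_support) (use F finR in \<open>auto simp: R_def\<close>)
  also have "\<dots> = (\<Sum>x\<in>F. \<bar>d k x\<bar>) + (\<Sum>x\<in>R. \<bar>d k x\<bar>)"
    by (rule sum.union_disjoint) (use F finR in \<open>auto simp: R_def\<close>)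
  also have "(\<Sum>x\<in>R. \<bar>d k x\<bar>) = (\<Sum>x\<in>?P \<union> ?Q. \<bar>d k x\<bar>)"
    by (rule sum.cong) auto
  also have "\<dots> = (\<Sum>x\<in>?P. \<bar>d k x\<bar>) + (\<Sum>x\<in>?Q. \<bar>d k x\<bar>)"
    by (rule sum.union_disjoint) (use finR in auto)
  also have "(\<Sum>x\<in>?P. \<bar>d k x\<bar>) = (\<Sum>x\<in>?P. d k x)"
    by (rule sum.cong) auto
  also have "(\<Sum>x\<in>?Q. \<bar>d k x\<bar>) = - (\<Sum>x\<in>?Q. d k x)"
    unfolding sum_negf[symmetric] by (rule sum.cong) auto
  finally have "7/8 * e \<le> \<bar>sum (d k) ?P\<bar> + \<bar>sum (d k) ?Q\<bar>"
    using small k(2) by linarith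
  \<comment> \<open>One of the two signs carries at least half of the mass outside \<open>F\<close>; the loss of at most \<open>e/8\<close> on \<open>A\<close> leaves
    \<open>7/16 * e - e/8\<close>, which exceeds \<open>e/4\<close>.\<close>
  then obtain Z where Z: "Z \<subseteq> R" "7/16 * e \<le> \<bar>sum (d k) Z\<bar>"
  proof (cases "7/16 * e \<le> \<bar>sum (d k) ?P\<bar>")
    case True
    then show ?thesis using that[of ?P] by auto
  next
    case False
    with \<open>7/8 * e \<le> _\<close> have "7/16 * e \<le> \<bar>sum (d k) ?Q\<bar>" by linarith
    then show ?thesis using that[of ?Q] by auto
  qed
  have "finite A" using F finite_subset by blast
  then have "sum (d k) (A \<union> Z) = sum (d k) A + sum (d k) Z"
    using F(3) Z(1) finR finite_subset
    by (intro sum.union_disjoint) (auto simp: R_def)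
  moreover have "\<bar>sum (d k) A\<bar> \<le> (\<Sum>x\<in>F. \<bar>d k x\<bar>)"
    by (rule order_trans[OF sum_abs sum_mono2[OF F(1,3)]]) simp
  ultimately have "e / 4 \<le> \<bar>sum (d k) (A \<union> Z)\<bar>"
    using small Z(2) e by linarith
  then show ?thesis
    using that[of k "F \<union> R" "A \<union> Z"] k(1) F Z(1) finR by (auto simp: R_def)
qed

text \<open>
  Iterating the step yields sets \<open>A n\<close> whose union meets the support of the \<open>n\<close>-th chosen function in
  \<open>A n\<close> only. The sums over this single countable set then stay away from zero. Finiteness of the supports
  is what makes the union see no tails.
\<close>

lemma schur_finitely_supported:
  fixes d :: "nat \<Rightarrow> 'a \<Rightarrow> real"
  assumes fin: "\<And>k. finite {x \<in> X. d k x \<noteq> 0}"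
    and lim: "\<And>A. countable A \<Longrightarrow> A \<subseteq> X \<Longrightarrow> (\<lambda>k. infsum (d k) A) \<longlonglongrightarrow> 0"
  shows "(\<lambda>k. l1_norm X (d k)) \<longlonglongrightarrow> 0"
proof (rule ccontr)
  assume "\<not> ?thesis"
  then obtain e where e: "e > 0" and big: "\<And>N. \<exists>k\<ge>N. e \<le> l1_norm X (d k)"
    using l1_norm_nonneg[of X] by (auto simp: LIMSEQ_iff not_less)
  have pt: "(\<lambda>k. d k x) \<longlonglongrightarrow> 0" if "x \<in> X" for x
    using lim[of "{x}"] that by simp
  \<comment> \<open>A state \<open>(k, F, A)\<close> holds the chosen index, a finite set containing all supports met so far, and the part of
    the final set already fixed inside \<open>F\<close>.\<close>
  let ?ok = "\<lambda>(k, F, A). finite F \<and> F \<subseteq> X \<and> A \<subseteq> F \<and> {x \<in> X. d k x \<noteq> 0} \<subseteq> F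
      \<and> e / 4 \<le> \<bar>sum (d k) A\<bar>"
  let ?next = "\<lambda>(k, F, A) (k', F', A'). k < (k'::nat) \<and> F \<subseteq> F' \<and> A' \<inter> F = A"
  have "\<exists>s. \<forall>n. ?ok (s n) \<and> ?next (s n) (s (Suc n))"
  proof (rule dependent_nat_choice)
    show "\<exists>s. ?ok s"
      using gliding_hump_step[OF fin pt e big, of "{}" "{}"] by fastforce
  next
    fix s and n :: nat assume ok: "?ok s"
    obtain k F A where s: "s = (k, F, A)" by (cases s)
    obtain k' F' A' where "k < k'" "finite F'" "F' \<subseteq> X" "F \<subseteq> F'" "{x \<in> X. d k' x \<noteq> 0} \<subseteq> F'"
        "A' \<subseteq> F'" "A' \<inter> F = A" "e / 4 \<le> \<bar>sum (d k') A'\<bar>"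
      using gliding_hump_step[OF fin pt e big, of F A k] ok s by auto
    then show "\<exists>s'. ?ok s' \<and> ?next s s'"
      by (intro exI[of _ "(k', F', A')"]) (simp add: s)
  qed
  then obtain s where "\<forall>n. ?ok (s n) \<and> ?next (s n) (s (Suc n))" ..
  then have s: "\<And>n. ?ok (s n)" "\<And>n. ?next (s n) (s (Suc n))" by simp_all
  define k where "k n = fst (s n)" for n
  define F where "F n = fst (snd (s n))" for n
  define A where "A n = snd (snd (s n))" for n
  have s_eq: "s n = (k n, F n, A n)" for n by (simp add: k_def F_def A_def)
  have F: "finite (F n)" "F n \<subseteq> X" "A n \<subseteq> F n" "{x \<in> X. d (k n) x \<noteq> 0} \<subseteq> F n"
    and large: "e / 4 \<le> \<bar>sum (d (k n)) (A n)\<bar>" for n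
    using s(1)[of n] by (auto simp: s_eq)
  have step: "k n < k (Suc n)" "F n \<subseteq> F (Suc n)" "A (Suc n) \<inter> F n = A n" for n
    using s(2)[of n] by (auto simp: s_eq)
  have Fmono: "F n \<subseteq> F m" if "n \<le> m" for n m
    using that by (rule lift_Suc_mono_le[of F, rotated]) (rule step)
  have Amono: "A n \<subseteq> A m" if "n \<le> m" for n m
    using that by (rule lift_Suc_mono_le[of A, rotated]) (use step(3) in blast)
  have stable: "A m \<inter> F n = A n" if "n \<le> m" for n m
    using that
  proof (induction m rule: dec_induct)
    case base
    then show ?case using F(3) by blast
  next
    case (step m)
    then show ?case using Fmono[of n m] \<open>\<And>n. A (Suc n) \<inter> F n = A n\<close> by blast
  qed
  let ?A = "\<Union>n. A n"
  \<comment> \<open>Later points lie outside \<open>F n\<close> and earlier ones already belong to \<open>A n\<close>.\<close>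
  have "?A \<inter> F n \<subseteq> A n" for n
  proof clarify
    fix x m assume "x \<in> F n" "x \<in> A m"
    then show "x \<in> A n"
      using stable[of n m] Amono[of m n] by (cases "n \<le> m") auto
  qed
  note inter = this
  have eq: "infsum (d (k n)) ?A = sum (d (k n)) (A n)" for n
  proof (rule infsum_finite_support)
    show "A n \<subseteq> ?A" by blast
    show "finite (A n)" using F(1,3) by (rule finite_subset[rotated])
    fix x assume x: "x \<in> ?A - A n"
    then have "x \<in> X" using F(2,3) by blast
    moreover have "x \<notin> F n" using x inter[of n] by blast
    ultimately show "d (k n) x = 0" using F(4)[of n] by blast
  qed
  have "countable ?A"
    using finite_subset[OF F(3) F(1)] by (simp add: countable_finite)
  moreover have "?A \<subseteq> X" using F(2,3) by blast
  ultimately have "(\<lambda>k. infsum (d k) ?A) \<longlonglongrightarrow> 0" by (rule lim)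
  moreover have "strict_mono k" by (simp add: strict_mono_Suc_iff step)
  ultimately have "((\<lambda>k. infsum (d k) ?A) \<circ> k) \<longlonglongrightarrow> 0"
    by (rule LIMSEQ_subseq_LIMSEQ)
  then have "(\<lambda>n. \<bar>sum (d (k n)) (A n)\<bar>) \<longlonglongrightarrow> 0"
    by (intro tendsto_rabs_zero) (simp add: o_def eq)
  then have "e / 4 \<le> 0" by (rule LIMSEQ_le_const) (use large in blast)
  with e show False by simp
qed

text \<open>
  Convergence to an unknown limit reduces to convergence to zero by passing to differences of late terms.
\<close>

lemma schur_finitely_supported_Cauchy:
  fixes a :: "nat \<Rightarrow> 'a \<Rightarrow> real"
  assumes fin: "\<And>k. finite {x \<in> X. a k x \<noteq> 0}" and a: "\<And>k. a k summable_on X"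
    and conv: "\<And>A. countable A \<Longrightarrow> A \<subseteq> X \<Longrightarrow> convergent (\<lambda>k. infsum (a k) A)"
  shows "l1_Cauchy X a"
proof (rule ccontr)
  assume "\<not> l1_Cauchy X a"
  then obtain e p q where e: "e > 0" and pq: "filterlim p sequentially sequentially"
      "filterlim q sequentially sequentially"
    and large: "\<And>k. e \<le> l1_norm X (\<lambda>x. a (p k) x - a (q k) x)"
    by (rule not_l1_CauchyE) blast
  have "(\<lambda>k. l1_norm X (\<lambda>x. a (p k) x - a (q k) x)) \<longlonglongrightarrow> 0"
  proof (rule schur_finitely_supported)
    show "finite {x \<in> X. a (p k) x - a (q k) x \<noteq> 0}" for k
      by (rule finite_subset[OF _ finite_UnI[OF fin[of "p k"] fin[of "q k"]]]) auto
    fix A assume A: "countable A" "A \<subseteq> X"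
    then obtain l where l: "(\<lambda>k. infsum (a k) A) \<longlonglongrightarrow> l"
      using conv by (auto simp: convergent_def)
    have "(\<lambda>k. infsum (a (p k)) A - infsum (a (q k)) A) \<longlonglongrightarrow> l - l"
      by (intro tendsto_diff filterlim_compose[OF l] pq)
    then show "(\<lambda>k. \<Sum>\<^sub>\<infinity>x\<in>A. a (p k) x - a (q k) x) \<longlonglongrightarrow> 0"
      by (simp add: infsum_diff_real summable_on_subset[OF a A(2)])
  qed
  then have "e \<le> 0" by (rule LIMSEQ_le_const) (use large in blast)
  with e show False by simp
qed

section \<open>Truncation to finite supports\<close>

text \<open>
  If the finite set \<open>F\<close> carries mass \<open>s\<close>, then dropping the rest of \<open>a\<close> costs \<open>1 - s\<close>, and rescaling what remains
  to norm one costs another \<open>1 - s\<close>.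
\<close>

lemma l1_truncate:
  fixes a :: "'a \<Rightarrow> real"
  assumes a: "a summable_on X" "l1_norm X a = 1" and e: "e > 0"
  obtains c where "finite {x \<in> X. c x \<noteq> 0}" "c summable_on X" "l1_norm X c = 1"
    "l1_norm X (\<lambda>x. a x - c x) \<le> e"
proof -
  \<comment> \<open>The bound \<open>1/2\<close> keeps the retained mass positive, and \<open>e/2\<close> leaves room for the two losses.\<close>
  let ?d = "min (1/2) (e/2)"
  have abs: "(\<lambda>x. \<bar>a x\<bar>) summable_on X" using a(1) by (simp add: summable_on_abs)
  obtain F where F: "finite F" "F \<subseteq> X" "dist (\<Sum>x\<in>F. \<bar>a x\<bar>) 1 \<le> ?d"
    using infsum_finite_approximation[OF abs, of ?d] e a(2) by (auto simp: l1_norm_def)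
  define s where "s = (\<Sum>x\<in>F. \<bar>a x\<bar>)"
  have s: "1/2 \<le> s" "1 - s \<le> e / 2" using F(3) unfolding s_def dist_real_def by linarith+
  have split: "l1_norm X b = (\<Sum>x\<in>F. \<bar>b x\<bar>) + l1_norm (X - F) b" if "b summable_on X" for b :: "'a \<Rightarrow> real"
  proof -
    have b: "(\<lambda>x. \<bar>b x\<bar>) summable_on X" using that by (simp add: summable_on_abs)
    have "l1_norm X b = (\<Sum>\<^sub>\<infinity>x\<in>F \<union> (X - F). \<bar>b x\<bar>)"
      unfolding l1_norm_def using F(2) by (intro infsum_cong_neutral) auto
    also have "\<dots> = (\<Sum>\<^sub>\<infinity>x\<in>F. \<bar>b x\<bar>) + l1_norm (X - F) b"
      unfolding l1_norm_def by (rule infsum_Un_disjoint) (use F in \<open>auto intro: summable_on_subset[OF b]\<close>)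
    finally show ?thesis using F(1) by simp
  qed
  have s1: "s \<le> 1" using split[OF a(1)] a(2) l1_norm_nonneg[of "X - F" a] by (simp add: s_def)
  define c where "c x = (if x \<in> F then a x / s else 0)" for x
  have fin: "finite {x \<in> X. c x \<noteq> 0}"
    by (rule finite_subset[OF _ F(1)]) (auto simp: c_def)
  have c: "c summable_on X"
    using F summable_on_cong_neutral[of X F c c] by (auto simp: c_def)
  have zero: "l1_norm (X - F) c = 0"
    unfolding l1_norm_def by (rule infsum_0) (simp add: c_def)
  have "(\<Sum>x\<in>F. \<bar>c x\<bar>) = 1"
    using s by (simp add: c_def abs_divide sum_divide_distrib[symmetric] s_def[symmetric])
  then have "l1_norm X c = 1" using split[OF c] zero by simp
  moreover have "l1_norm X (\<lambda>x. a x - c x) \<le> e"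
  proof -
    have "(\<Sum>x\<in>F. \<bar>a x - c x\<bar>) = (\<Sum>x\<in>F. \<bar>a x\<bar> * (1 / s - 1))"
    proof (rule sum.cong)
      fix x assume "x \<in> F"
      then have "a x - c x = - (a x * (1 / s - 1))" by (simp add: c_def algebra_simps)
      then have "\<bar>a x - c x\<bar> = \<bar>a x\<bar> * \<bar>1 / s - 1\<bar>" by (simp only: abs_minus_cancel abs_mult)
      then show "\<bar>a x - c x\<bar> = \<bar>a x\<bar> * (1 / s - 1)" using s s1 by (simp add: field_simps)
    qed simp
    also have "\<dots> = s * (1 / s - 1)" by (simp add: sum_distrib_right s_def)
    also have "\<dots> = 1 - s" using s by (simp add: field_simps)
    finally have "(\<Sum>x\<in>F. \<bar>a x - c x\<bar>) = 1 - s" .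
    moreover have "l1_norm (X - F) (\<lambda>x. a x - c x) = l1_norm (X - F) a"
      unfolding l1_norm_def by (rule infsum_cong) (simp add: c_def)
    moreover have "l1_norm (X - F) a = 1 - s" using split[OF a(1)] a(2) by (simp add: s_def)
    ultimately show ?thesis using split[OF summable_on_diff_real[OF a(1) c]] s by simp
  qed
  ultimately show ?thesis using that fin c by blast
qed

section \<open>The Grothendieck and Josefson--Nissenzweig properties\<close>

text \<open>
  A finite subset of \<open>K\<close> is closed and discrete, so this is an instance of Tietze's theorem.
\<close>

lemma interpolation_finite_set:
  assumes K: "compact_space K" "Hausdorff_space K"
    and S: "finite S" "S \<subseteq> topspace K" and g: "\<And>x. x \<in> S \<Longrightarrow> \<bar>g x\<bar> \<le> (1::real)"
  obtains f where "continuous_map K euclideanreal f" "\<And>x. x \<in> topspace K \<Longrightarrow> \<bar>f x\<bar> \<le> 1"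
    "\<And>x. x \<in> S \<Longrightarrow> f x = g x"
proof -
  have "subtopology K S = discrete_topology S"
    using K(2) S by (intro subtopology_eq_discrete_topology_finite Hausdorff_imp_t1_space)
  then have "continuous_map (subtopology K S) euclideanreal g" by simp
  moreover have "normal_space K" using K by (blast intro: compact_Hausdorff_or_regular_imp_normal_space)
  moreover have "closedin K S"
    using K(2) S by (intro compactin_imp_closedin finite_imp_compactin)
  ultimately obtain f where "continuous_map K euclideanreal f" "\<And>x. x \<in> S \<Longrightarrow> f x = g x"
      "f ` topspace K \<subseteq> {-1..1}"
    using g by (elim Tietze_extension_closed_real_interval[of K S g "-1" 1]) (auto simp: abs_le_iff)
  then show ?thesis using that by (fastforce simp: abs_le_iff)
qed

text \<open>
  Weak* convergence to zero of the measures with point masses \<open>c n\<close>, expressed through those masses.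
\<close>

definition weak_star_null :: "'a topology \<Rightarrow> (nat \<Rightarrow> 'a \<Rightarrow> real) \<Rightarrow> bool" where
  "weak_star_null K c \<longleftrightarrow> (\<forall>f. continuous_map K euclideanreal f \<longrightarrow>
     (\<lambda>n. \<Sum>\<^sub>\<infinity>x\<in>topspace K. c n x * f x) \<longlonglongrightarrow> 0)"

context
  fixes K :: "'a topology"
  assumes K: "compact_space K" "Hausdorff_space K"
begin

lemma JN_sequence_atomic_iff:
  assumes "\<And>n. atomic K (c n) (\<mu> n)"
  shows "JN_sequence K \<mu> \<longleftrightarrow>
    (\<forall>n. l1_norm (topspace K) (c n) = 1) \<and> weak_star_null K c"
proof -
  have "atomic K (\<lambda>x. 0) (\<lambda>B. 0)" by (simp add: atomic_def)
  then have "signed_integral (borel_of K) (\<lambda>B. 0) f = 0" if "continuous_map K euclideanreal f" for f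
    using signed_integral_atomic[OF K _ that] by fastforce
  then have "weak_star_converges K \<mu> (\<lambda>B. 0) \<longleftrightarrow> weak_star_null K c"
    by (simp add: weak_star_converges_def weak_star_null_def
        signed_integral_atomic[OF K assms])
  then show ?thesis
    unfolding JN_sequence_def using atomic_radon[OF K(2) assms]
    by (simp add: tv_norm_atomic[OF K(2) assms])
qed

lemma csJNP_iff:
  "csJNP K \<longleftrightarrow> (\<exists>c. (\<forall>n. c n summable_on topspace K \<and> l1_norm (topspace K) (c n) = 1)
     \<and> weak_star_null K c)"
proof
  assume "csJNP K"
  then obtain \<mu> where \<mu>: "JN_sequence K \<mu>" "\<And>n. \<mu> n \<in> ell1 K" by (auto simp: csJNP_def)
  then have "\<forall>n. \<exists>c. atomic K c (\<mu> n)" by (simp add: ell1_iff_atomic[OF K(2)])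
  then obtain c where c: "\<And>n. atomic K (c n) (\<mu> n)" by metis
  then show "\<exists>c. (\<forall>n. c n summable_on topspace K \<and> l1_norm (topspace K) (c n) = 1)
     \<and> weak_star_null K c"
    using c \<mu>(1) JN_sequence_atomic_iff[where c = c and \<mu> = \<mu>, OF c] by (auto simp: atomic_def)
next
  assume "\<exists>c. (\<forall>n. c n summable_on topspace K \<and> l1_norm (topspace K) (c n) = 1)
     \<and> weak_star_null K c"
  then obtain c where c: "\<And>n. c n summable_on topspace K"
      "\<And>n. l1_norm (topspace K) (c n) = 1" "weak_star_null K c" by blast
  note at = atomic_infsum[OF c(1)]
  have "JN_sequence K (\<lambda>n. infsum (c n))" using JN_sequence_atomic_iff[where c = c, OF at] c by simp
  then show "csJNP K"
    unfolding csJNP_def using at ell1_iff_atomic[OF K(2)] by blast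
qed

lemma fsJNP_iff:
  "fsJNP K \<longleftrightarrow> (\<exists>c. (\<forall>n. c n summable_on topspace K \<and> finite {x \<in> topspace K. c n x \<noteq> 0}
     \<and> l1_norm (topspace K) (c n) = 1) \<and> weak_star_null K c)"
proof
  assume "fsJNP K"
  then obtain \<mu> where \<mu>: "JN_sequence K \<mu>" "\<And>n. \<mu> n \<in> Delta K" by (auto simp: fsJNP_def)
  then have "\<forall>n. \<exists>c. atomic K c (\<mu> n) \<and> finite {x \<in> topspace K. c x \<noteq> 0}"
    by (simp add: Delta_iff_atomic[OF K(2)])
  then obtain c where c: "\<And>n. atomic K (c n) (\<mu> n)" "\<And>n. finite {x \<in> topspace K. c n x \<noteq> 0}"
    by metis
  then show "\<exists>c. (\<forall>n. c n summable_on topspace K \<and> finite {x \<in> topspace K. c n x \<noteq> 0}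
     \<and> l1_norm (topspace K) (c n) = 1) \<and> weak_star_null K c"
    using c \<mu>(1) JN_sequence_atomic_iff[where c = c and \<mu> = \<mu>, OF c(1)]
    by (intro exI[of _ c]) (simp add: atomic_def)
next
  assume "\<exists>c. (\<forall>n. c n summable_on topspace K \<and> finite {x \<in> topspace K. c n x \<noteq> 0}
     \<and> l1_norm (topspace K) (c n) = 1) \<and> weak_star_null K c"
  then obtain c where c: "\<And>n. c n summable_on topspace K"
      "\<And>n. finite {x \<in> topspace K. c n x \<noteq> 0}"
      "\<And>n. l1_norm (topspace K) (c n) = 1" "weak_star_null K c" by blast
  note at = atomic_infsum[OF c(1)]
  have "JN_sequence K (\<lambda>n. infsum (c n))" using JN_sequence_atomic_iff[where c = c, OF at] c by simp
  then show "fsJNP K"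
    unfolding fsJNP_def using at c(2) Delta_iff_atomic[OF K(2)] by blast
qed

lemma Delta_subset_ell1: "Delta K \<subseteq> ell1 K"
  using Delta_iff_atomic[OF K(2)] ell1_iff_atomic[OF K(2)] by blast

text \<open>
  The truncation error of the \<open>n\<close>-th term is made at most \<open>inverse (Suc n)\<close>, so that it disappears in the limit.
\<close>

lemma csJNP_imp_fsJNP:
  assumes "csJNP K"
  shows "fsJNP K"
proof -
  let ?X = "topspace K"
  obtain a where a: "\<And>n. a n summable_on ?X" "\<And>n. l1_norm ?X (a n) = 1"
      "weak_star_null K a"
    using assms csJNP_iff by blast
  have "\<forall>n. \<exists>c. finite {x \<in> ?X. c x \<noteq> 0} \<and> c summable_on ?X \<and> l1_norm ?X c = 1
      \<and> l1_norm ?X (\<lambda>x. a n x - c x) \<le> inverse (real (Suc n))" (is "\<forall>n. \<exists>c. ?P n c")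
  proof
    fix n
    have "0 < inverse (real (Suc n))" by simp
    from l1_truncate[OF a(1)[of n] a(2)[of n] this] show "\<exists>c. ?P n c" by blast
  qed
  then obtain c where "\<forall>n. ?P n (c n)" by (rule choice[THEN exE])
  then have c: "\<And>n. finite {x \<in> ?X. c n x \<noteq> 0}" "\<And>n. c n summable_on ?X"
      "\<And>n. l1_norm ?X (c n) = 1" "\<And>n. l1_norm ?X (\<lambda>x. a n x - c n x) \<le> inverse (real (Suc n))"
    by blast+
  have close: "(\<lambda>n. l1_norm ?X (\<lambda>x. a n x - c n x)) \<longlonglongrightarrow> 0"
  proof (rule Lim_null_comparison[OF always_eventually[OF allI] LIMSEQ_inverse_real_of_nat])
    show "norm (l1_norm ?X (\<lambda>x. a n x - c n x)) \<le> inverse (real (Suc n))" for n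
      using c(4)[of n] by (simp only: real_norm_def abs_of_nonneg l1_norm_nonneg)
  qed
  have "weak_star_null K c"
    unfolding weak_star_null_def
  proof (intro allI impI)
    fix f assume f: "continuous_map K euclideanreal f"
    obtain C where C: "\<And>x. x \<in> ?X \<Longrightarrow> \<bar>f x\<bar> \<le> C"
      using continuous_map_compact_bounded[OF K(1) f] by blast
    show "(\<lambda>n. \<Sum>\<^sub>\<infinity>x\<in>?X. c n x * f x) \<longlonglongrightarrow> 0"
      by (rule infsum_mult_tendsto_l1_close[where f = f, OF a(1) c(2) close C])
        (use a(3) f in \<open>auto simp: weak_star_null_def\<close>)
  qed
  then show ?thesis using c fsJNP_iff by blast
qed

text \<open>
  A continuous function of supremum norm at most one that equals the sign of \<open>c N\<close> on its finite
  support integrates \<open>c N\<close> to one, and hence integrates every function at distance less than \<open>1/2\<close> from \<open>c N\<close> to at least \<open>1/2\<close>.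
\<close>

lemma l1_Cauchy_not_weak_star_null:
  assumes c: "\<And>n. c n summable_on topspace K" "\<And>n. finite {x \<in> topspace K. c n x \<noteq> 0}"
    and norm: "\<And>n. l1_norm (topspace K) (c n) = 1" and C: "l1_Cauchy (topspace K) c"
  shows "\<not> weak_star_null K c"
proof
  let ?X = "topspace K"
  assume null: "weak_star_null K c"
  obtain N where N: "\<And>n. n \<ge> N \<Longrightarrow> l1_norm ?X (\<lambda>x. c n x - c N x) < 1/2"
    using C unfolding l1_Cauchy_def by (meson half_gt_zero_iff order_refl zero_less_one)
  let ?S = "{x \<in> ?X. c N x \<noteq> 0}"
  obtain f where f: "continuous_map K euclideanreal f" "\<And>x. x \<in> ?X \<Longrightarrow> \<bar>f x\<bar> \<le> 1"
      "\<And>x. x \<in> ?S \<Longrightarrow> f x = sgn (c N x)"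
    by (rule interpolation_finite_set[OF K c(2)[of N], of "\<lambda>x. sgn (c N x)"]) (auto simp: sgn_if)
  have "(\<Sum>\<^sub>\<infinity>x\<in>?X. c N x * f x) = l1_norm ?X (c N)"
    unfolding l1_norm_def
  proof (rule infsum_cong)
    fix x assume "x \<in> ?X"
    then show "c N x * f x = \<bar>c N x\<bar>"
      using f(3)[of x] by (cases "c N x = 0") (auto simp: abs_sgn)
  qed
  then have one: "(\<Sum>\<^sub>\<infinity>x\<in>?X. c N x * f x) = 1" using norm by simp
  have "1/2 \<le> (\<Sum>\<^sub>\<infinity>x\<in>?X. c n x * f x)" if n: "n \<ge> N" for n
  proof -
    have "\<bar>\<Sum>\<^sub>\<infinity>x\<in>?X. (c n x - c N x) * f x\<bar> < 1/2"
      using infsum_mult_le_l1_norm[where f = f, OF summable_on_diff_real[OF c(1)[of n] c(1)[of N]] f(2)] N[OF n]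
      by simp
    moreover have "(\<Sum>\<^sub>\<infinity>x\<in>?X. (c n x - c N x) * f x)
        = (\<Sum>\<^sub>\<infinity>x\<in>?X. c n x * f x) - (\<Sum>\<^sub>\<infinity>x\<in>?X. c N x * f x)"
      unfolding left_diff_distrib
      by (rule infsum_diff_real) (auto intro: summable_on_bounded_mult[where f = f, OF c(1) f(2)])
    ultimately show ?thesis using one by linarith
  qed
  moreover have "(\<lambda>n. \<Sum>\<^sub>\<infinity>x\<in>?X. c n x * f x) \<longlonglongrightarrow> 0"
    using null f(1) by (simp add: weak_star_null_def)
  ultimately have "1/2 \<le> (0::real)" by (intro LIMSEQ_le_const) auto
  then show False by simp
qed

text \<open>
  Countable sets are Borel in a Hausdorff space, so weak convergence supplies exactly the setwise convergence that
  the Schur property asks for.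
\<close>

lemma Delta_Grothendieck_imp_not_fsJNP:
  assumes G: "Delta_Grothendieck_property K"
  shows "\<not> fsJNP K"
proof
  let ?X = "topspace K"
  assume "fsJNP K"
  then obtain c where c: "\<And>n. c n summable_on ?X" "\<And>n. finite {x \<in> ?X. c n x \<noteq> 0}"
      "\<And>n. l1_norm ?X (c n) = 1" "weak_star_null K c"
    using fsJNP_iff by blast
  note at = atomic_infsum[OF c(1)]
  have "JN_sequence K (\<lambda>n. infsum (c n))" using JN_sequence_atomic_iff[where c = c, OF at] c by simp
  then have "weak_star_converges K (\<lambda>n. infsum (c n)) (\<lambda>B. 0)" by (simp add: JN_sequence_def)
  moreover have "(\<lambda>B. 0) \<in> radon_measures K"
    by (rule atomic_radon[OF K(2), of "\<lambda>x. 0"]) (simp add: atomic_def)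
  moreover have "\<And>n. infsum (c n) \<in> Delta K"
    using at c(2) Delta_iff_atomic[OF K(2)] by blast
  ultimately obtain \<nu> where "weakly_converges K (\<lambda>n. infsum (c n)) \<nu>"
    using G[unfolded Delta_Grothendieck_property_def grothendieck_for_def,
        THEN spec[of _ "\<lambda>n. infsum (c n)"]] by blast
  then have "convergent (\<lambda>n. infsum (c n) A)" if "countable A" "A \<subseteq> ?X" for A
    using countable_sets_borel_of[OF K(2) that] by (auto simp: weakly_converges_def convergent_def)
  then have "l1_Cauchy ?X c"
    using c by (intro schur_finitely_supported_Cauchy)
  with l1_Cauchy_not_weak_star_null[where c = c, OF c(1-3)] c(4) show False by blast
qed

text \<open>
  The contrapositive is a normalisation argument: dividing the differences of late terms by their norms \<open>t k\<close> keeps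
  them weak* null precisely because the \<open>t k\<close> are bounded below by \<open>e\<close>.
\<close>

lemma not_csJNP_imp_ell1_Grothendieck:
  assumes "\<not> csJNP K"
  shows "ell1_Grothendieck_property K"
  unfolding ell1_Grothendieck_property_def grothendieck_for_def
proof (intro allI impI)
  let ?X = "topspace K"
  fix \<mu> assume \<mu>: "\<forall>n. \<mu> n \<in> ell1 K" and "\<exists>\<nu>\<in>radon_measures K. weak_star_converges K \<mu> \<nu>"
  then obtain \<nu> where \<nu>: "weak_star_converges K \<mu> \<nu>" by blast
  from \<mu> have "\<forall>n. \<exists>a. atomic K a (\<mu> n)" by (simp add: ell1_iff_atomic[OF K(2)])
  then obtain a where at: "\<And>n. atomic K (a n) (\<mu> n)" by metis
  then have a: "\<And>n. a n summable_on ?X" by (simp add: atomic_def)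
  have "l1_Cauchy ?X a"
  proof (rule ccontr)
    assume "\<not> l1_Cauchy ?X a"
    then obtain e p q where e: "e > 0" and pq: "filterlim p sequentially sequentially"
        "filterlim q sequentially sequentially"
      and large: "\<And>k. e \<le> l1_norm ?X (\<lambda>x. a (p k) x - a (q k) x)"
      by (rule not_l1_CauchyE) blast
    define t where "t k = l1_norm ?X (\<lambda>x. a (p k) x - a (q k) x)" for k
    have t: "e \<le> t k" for k using large by (simp add: t_def)
    then have tpos: "t k > 0" for k using e by (meson less_le_trans)
    define d where "d k x = (a (p k) x - a (q k) x) / t k" for k x
    have d: "d k summable_on ?X" for k
      unfolding d_def divide_inverse by (intro summable_on_cmult_left summable_on_diff_real a)
    have "l1_norm ?X (d k) = 1" for k
      unfolding d_def using l1_norm_divide[of ?X "\<lambda>x. a (p k) x - a (q k) x" "t k"] tpos[of k]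
      by (simp add: t_def)
    moreover have "weak_star_null K d"
      unfolding weak_star_null_def
    proof (intro allI impI)
      fix f assume f: "continuous_map K euclideanreal f"
      obtain C where C: "\<And>x. x \<in> ?X \<Longrightarrow> \<bar>f x\<bar> \<le> C"
        using continuous_map_compact_bounded[OF K(1) f] by blast
      define I where "I n = (\<Sum>\<^sub>\<infinity>x\<in>?X. a n x * f x)" for n
      have I: "I \<longlonglongrightarrow> signed_integral (borel_of K) \<nu> f"
        using \<nu> f unfolding weak_star_converges_def I_def
        by (simp add: signed_integral_atomic[OF K at])
      have eq: "(\<Sum>\<^sub>\<infinity>x\<in>?X. d k x * f x) = (I (p k) - I (q k)) / t k" for k
      proof -
        have "(\<Sum>\<^sub>\<infinity>x\<in>?X. d k x * f x)
            = (\<Sum>\<^sub>\<infinity>x\<in>?X. (a (p k) x * f x - a (q k) x * f x) * inverse (t k))"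
          by (rule infsum_cong) (simp add: d_def divide_inverse algebra_simps)
        also have "\<dots> = (I (p k) - I (q k)) * inverse (t k)"
          unfolding infsum_cmult_left' I_def
          by (subst infsum_diff_real) (auto intro: summable_on_bounded_mult[where f = f, OF a C])
        finally show ?thesis by (simp add: divide_inverse)
      qed
      have "(\<lambda>k. I (p k) - I (q k)) \<longlonglongrightarrow> signed_integral (borel_of K) \<nu> f - signed_integral (borel_of K) \<nu> f"
        by (intro tendsto_diff filterlim_compose[OF I] pq)
      then have to0: "(\<lambda>k. \<bar>I (p k) - I (q k)\<bar> / e) \<longlonglongrightarrow> 0"
        by (intro tendsto_divide_zero tendsto_rabs_zero) simp
      have bound: "norm (\<Sum>\<^sub>\<infinity>x\<in>?X. d k x * f x) \<le> \<bar>I (p k) - I (q k)\<bar> / e" for k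
        using t[of k] tpos[of k] e by (simp add: eq abs_divide divide_left_mono)
      show "(\<lambda>k. \<Sum>\<^sub>\<infinity>x\<in>?X. d k x * f x) \<longlonglongrightarrow> 0"
        by (rule Lim_null_comparison[OF always_eventually[OF allI] to0]) (rule bound)
    qed
    ultimately have "csJNP K" using d csJNP_iff by blast
    with assms show False by contradiction
  qed
  from l1_complete[OF a this] obtain b
    where b: "b summable_on ?X" "(\<lambda>n. l1_norm ?X (\<lambda>x. a n x - b x)) \<longlonglongrightarrow> 0" .
  have "weakly_converges K \<mu> (infsum b)"
    unfolding weakly_converges_def
  proof
    fix B assume B: "B \<in> sets (borel_of K)"
    have sub: "B \<subseteq> ?X" using B by (rule sets_borel_of_subset)
    have "norm (\<mu> n B - infsum b B) \<le> l1_norm ?X (\<lambda>x. a n x - b x)" for n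
      using infsum_subset_le_l1_norm[OF summable_on_diff_real[OF a[of n] b(1)] sub]
        infsum_diff_real[OF summable_on_subset[OF a[of n] sub] summable_on_subset[OF b(1) sub]]
        at[of n] B
      by (simp add: atomic_def)
    then have "(\<lambda>n. \<mu> n B - infsum b B) \<longlonglongrightarrow> 0"
      by (rule Lim_null_comparison[OF always_eventually[OF allI] b(2)])
    then show "(\<lambda>n. \<mu> n B) \<longlonglongrightarrow> infsum b B" by (simp add: LIM_zero_iff)
  qed
  moreover have "infsum b \<in> radon_measures K"
    using atomic_radon[OF K(2) atomic_infsum[OF b(1)]] .
  ultimately show "\<exists>\<nu>\<in>radon_measures K. weakly_converges K \<mu> \<nu>" by blast
qed

end

theorem theorem6p7:
  fixes K :: "'a topology"
  assumes "compact_space K" and "Hausdorff_space K"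
  shows "(ell1_Grothendieck_property K \<longleftrightarrow> Delta_Grothendieck_property K) \<and>
         (Delta_Grothendieck_property K \<longleftrightarrow> \<not> fsJNP K) \<and>
         (\<not> fsJNP K \<longleftrightarrow> \<not> csJNP K)"
proof -
  have "Delta_Grothendieck_property K" if "ell1_Grothendieck_property K"
    using that Delta_subset_ell1[OF assms]
    unfolding ell1_Grothendieck_property_def Delta_Grothendieck_property_def grothendieck_for_def
    by blast
  then show ?thesis
    using Delta_Grothendieck_imp_not_fsJNP[OF assms] csJNP_imp_fsJNP[OF assms]
      not_csJNP_imp_ell1_Grothendieck[OF assms]
    by blast
qed

end
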